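(* Let $\sigma\in\mathcal S_n$ with $d(\sigma)=t$ and let $m_1,\dots,m_j$ be the cycle lengths of $\sigma$ (fixed points included). The number of paths of length $t$ from $I$ to $\sigma$ in $G_n$ is $$t!\prod_{i=1}^{j}\frac{m_i^{m_i-2}}{(m_i-1)!}.$$ If $t=\lfloor cn/2\rfloor$ with $0<c<1$, then the Radon–Nikodym derivative $r=d\nu_0/d\mu$ satisfies $$r(\sigma)=K_{n,t}\prod_{i=1}^{j}\frac{m_i^{m_i-2}}{(m_i-1)!},$$ where $K_{n,t}$ is a constant that only depends on $n$ and $t$.
   Context: $\mathcal S_n$ is the set of permutations of $\{1,\dots,n\}$, $G_n$ is the Cayley graph of $\mathcal S_n$ with respect to the set of all transpositions, $I$ the identity and $d(\sigma)$ the graph distance from $I$ to $\sigma$. $\mu$ is the uniform distribution on the sphere $\{\sigma\in\mathcal S_n:d(\sigma)=t\}$. Let $\tau_1,\tau_2,\dots$ be i.i.d. uniform transpositions and consider the random walk with positions $I,\tau_1,\tau_1\tau_2,\dots$. A step is a fragmentation if it splits a cycle (equivalently, decreases the distance to $I$). $\nu_0$ is the law of $\tau_1\cdots\tau_t$ conditional on none of the first $t$ steps being a fragmentation (equivalently, the hitting distribution of the sphere of radius $t$ conditioned on no fragmentation before the hitting time). *)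

theory Defs
  imports "HOL-Probability.Probability" "HOL-Combinatorics.Combinatorics"
begin

definition perms :: "nat \<Rightarrow> (nat \<Rightarrow> nat) set" where
  "perms n = {\<sigma>. \<sigma> permutes {1..n}}"

text \<open>The qualified name avoids the clash with the transpose operations on lists and matrices.\<close>

definition transpositions :: "nat \<Rightarrow> (nat \<Rightarrow> nat) set" where
  "transpositions n = {Transposition.transpose a b | a b. a \<in> {1..n} \<and> b \<in> {1..n} \<and> a \<noteq> b}"

text \<open>Edges are given by right multiplication, so that the random walk below, whose
  positions are the partial products, moves along edges.\<close>

definition cayley_adj :: "nat \<Rightarrow> (nat \<Rightarrow> nat) \<Rightarrow> (nat \<Rightarrow> nat) \<Rightarrow> bool" where
  "cayley_adj n \<sigma> \<sigma>' \<longleftrightarrow> \<sigma> \<in> perms n \<and> (\<exists>\<tau>\<in>transpositions n. \<sigma>' = \<sigma> \<circ> \<tau>)"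

text \<open>Paths are lists of vertices; a path of length \<open>k\<close> has \<open>k + 1\<close> vertices.
  Repetitions are allowed, but a path of length \<open>dist\<^sub>G n \<sigma>\<close> from the identity
  to \<open>\<sigma>\<close> cannot have any.\<close>

definition paths :: "('v \<Rightarrow> 'v \<Rightarrow> bool) \<Rightarrow> nat \<Rightarrow> 'v \<Rightarrow> 'v \<Rightarrow> 'v list set" where
  "paths E k u v = {p. length p = k + 1 \<and> hd p = u \<and> last p = v \<and> successively E p}"

text \<open>Only meaningful for \<open>\<sigma> \<in> perms n\<close>: elsewhere no path exists.\<close>

definition dist\<^sub>G :: "nat \<Rightarrow> (nat \<Rightarrow> nat) \<Rightarrow> nat" where
  "dist\<^sub>G n \<sigma> = (LEAST k. paths (cayley_adj n) k id \<sigma> \<noteq> {})"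

definition sphere\<^sub>G :: "nat \<Rightarrow> nat \<Rightarrow> (nat \<Rightarrow> nat) set" where
  "sphere\<^sub>G n t = {\<sigma> \<in> perms n. dist\<^sub>G n \<sigma> = t}"

text \<open>Cycles are represented by their supports; a fixed point \<open>x\<close> contributes \<open>{x}\<close>.\<close>

definition cycles_of :: "nat \<Rightarrow> (nat \<Rightarrow> nat) \<Rightarrow> nat set set" where
  "cycles_of n \<sigma> = orbit \<sigma> ` {1..n}"

definition cycle_lengths :: "nat \<Rightarrow> (nat \<Rightarrow> nat) \<Rightarrow> nat multiset" where
  "cycle_lengths n \<sigma> = image_mset card (mset_set (cycles_of n \<sigma>))"

definition fragmentation :: "nat \<Rightarrow> (nat \<Rightarrow> nat) \<Rightarrow> (nat \<Rightarrow> nat) \<Rightarrow> bool" where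
  "fragmentation n \<sigma> \<sigma>' \<longleftrightarrow>
     (\<exists>C\<in>cycles_of n \<sigma>. \<exists>A\<in>cycles_of n \<sigma>'. \<exists>B\<in>cycles_of n \<sigma>'. A \<noteq> B \<and> C = A \<union> B)"

text \<open>The sequence is indexed from 1; \<open>\<tau> 0\<close> is unconstrained and never used.
  Such a sequence exists only for \<open>n \<ge> 2\<close>.\<close>

definition iid_uniform_transpositions ::
    "nat \<Rightarrow> 'a measure \<Rightarrow> (nat \<Rightarrow> 'a \<Rightarrow> nat \<Rightarrow> nat) \<Rightarrow> bool" where
  "iid_uniform_transpositions n M \<tau> \<longleftrightarrow>
     prob_space M \<and>
     prob_space.indep_vars M (\<lambda>_. count_space (transpositions n)) \<tau> {1..} \<and>
     (\<forall>i\<ge>1. distr M (count_space (transpositions n)) (\<tau> i)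
              = uniform_count_measure (transpositions n))"

primrec walk :: "(nat \<Rightarrow> 'a \<Rightarrow> nat \<Rightarrow> nat) \<Rightarrow> nat \<Rightarrow> 'a \<Rightarrow> nat \<Rightarrow> nat" where
  "walk \<tau> 0 \<omega> = id"
| "walk \<tau> (Suc k) \<omega> = walk \<tau> k \<omega> \<circ> \<tau> (Suc k) \<omega>"

definition no_fragmentation ::
    "nat \<Rightarrow> 'a measure \<Rightarrow> (nat \<Rightarrow> 'a \<Rightarrow> nat \<Rightarrow> nat) \<Rightarrow> nat \<Rightarrow> 'a set" where
  "no_fragmentation n M \<tau> t =
     {\<omega> \<in> space M. \<forall>k<t. \<not> fragmentation n (walk \<tau> k \<omega>) (walk \<tau> (Suc k) \<omega>)}"

text \<open>Both laws live on all of \<open>perms n\<close>, with the discrete sigma-algebra. Below,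
  \<open>uniform_measure M A\<close> is \<open>M\<close> conditioned on the event \<open>A\<close>.\<close>

definition sphere_law :: "nat \<Rightarrow> nat \<Rightarrow> (nat \<Rightarrow> nat) measure" where
  "sphere_law n t = uniform_measure (count_space (perms n)) (sphere\<^sub>G n t)"

definition no_frag_law ::
    "nat \<Rightarrow> 'a measure \<Rightarrow> (nat \<Rightarrow> 'a \<Rightarrow> nat \<Rightarrow> nat) \<Rightarrow> nat \<Rightarrow> (nat \<Rightarrow> nat) measure" where
  "no_frag_law n M \<tau> t =
     distr (uniform_measure M (no_fragmentation n M \<tau> t)) (count_space (perms n)) (walk \<tau> t)"

end

theory Submission
  imports Defs
begin

text \<open>
  Composing a permutation with the transposition of \<open>a\<close> and \<open>b\<close> cuts the cycle through both
  points in two if they lie in one cycle, and otherwise joins their two cycles. Hence every step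
  changes the number \<open>n - #cycles\<close>, called \<open>cycle_rank\<close> below, by exactly one; it is the
  distance from the identity, and a fragmentation is the same as a step that lowers it.

  Counting the shortest paths to \<open>\<sigma>\<close> by their last step expresses their number \<open>N \<sigma>\<close> as the sum
  of \<open>N (\<sigma> \<circ> \<tau>)\<close> over the transpositions \<open>\<tau>\<close> that cut a cycle of \<open>\<sigma>\<close>. A cycle of length \<open>m\<close> can
  be cut into lengths \<open>k\<close> and \<open>m - k\<close> starting from each of its \<open>m\<close> points (\<open>orbits_split\<close>),
  and every transposition is met twice in this way. For the product formula to satisfy this
  recursion, the weight \<open>f m = m ^ (m - 2) / (m - 1)!\<close> of a cycle has to obey
  \<open>m * (\<Sum>k = 1..<m. f k * f (m - k)) = 2 * (m - 1) * f m\<close>, which is a case of Abel's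
  generalisation of the binomial theorem (\<open>cycle_weight_convolution\<close>). The remaining factors
  \<open>m - 1\<close> add up over all cycles to the rank \<open>t\<close> and turn \<open>(t - 1)!\<close> into \<open>t!\<close>
  (\<open>card_minimal_cayley_paths\<close>).

  For the random walk, all sequences of \<open>t\<close> transpositions are equally likely, so the probability
  to be at \<open>\<sigma>\<close> at time \<open>t\<close> is proportional to the number of paths of length \<open>t\<close> to \<open>\<sigma>\<close>.
  There is no fragmentation among the first \<open>t\<close> steps exactly if the rank rises every time, that
  is, if the walk is on the sphere of radius \<open>t\<close> at time \<open>t\<close>
  (\<open>no_fragmentation_eq_sphere_hit\<close>). So the conditional law gives each point of the
  sphere a mass proportional to its number of shortest paths, and dividing by the constant mass of
  the uniform law yields the derivative.
\<close>

section \<open>Abel's binomial identity\<close>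

text \<open>The sum is, up to sign, the \<open>n\<close>-th finite difference of a polynomial of degree
  \<open>d < n\<close>. The induction peels off one factor \<open>x + k\<close>: the part with \<open>x\<close> is a smaller
  power, and in the part with \<open>k\<close> the factor is absorbed into the binomial coefficient,
  which lowers \<open>n\<close> and shifts \<open>x\<close>.\<close>

lemma alternating_binomial_sum_power_eq_0:
  fixes x :: "'a::comm_ring_1"
  assumes "d < n"
  shows "(\<Sum>k\<le>n. (-1) ^ k * of_nat (n choose k) * (x + of_nat k) ^ d) = 0"
  using assms
proof (induction d arbitrary: n x)
  case 0
  then show ?case by (simp add: choose_alternating_sum)
next
  case (Suc d)
  then obtain m where n: "n = Suc m" and m: "d < m" by (cases n) auto
  let ?T = "\<lambda>n x. \<Sum>k\<le>n. (-1) ^ k * of_nat (n choose k) * (x + of_nat k) ^ d :: 'a"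
  have "(\<Sum>k\<le>n. (-1) ^ k * of_nat (n choose k) * (x + of_nat k) ^ Suc d)
      = x * ?T n x + (\<Sum>k\<le>Suc m. (-1) ^ k * of_nat (k * (Suc m choose k)) * (x + of_nat k) ^ d)"
    unfolding n by (simp only: sum_distrib_left sum.distrib[symmetric])
      (rule sum.cong, simp_all add: algebra_simps)
  also have "(\<Sum>k\<le>Suc m. (-1) ^ k * of_nat (k * (Suc m choose k)) * (x + of_nat k) ^ d)
      = (\<Sum>k\<le>m. (-1) ^ Suc k * of_nat (Suc k * (Suc m choose Suc k)) * (x + of_nat (Suc k)) ^ d)"
    by (subst sum.atMost_Suc_shift) simp
  also have "\<dots> = - (of_nat (Suc m) * ?T m (x + 1))"
    unfolding Suc_times_binomial
    by (simp only: sum_distrib_left sum_negf[symmetric])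
      (rule sum.cong, simp_all add: algebra_simps)
  finally show ?case using Suc.IH[of n x] Suc.IH[OF m, of "x + 1"] n m by simp
qed

text \<open>Put \<open>z = x + y + n\<close>, so that \<open>y + (n - k) = z - (x + k)\<close>, and expand in powers of \<open>z\<close>.
  The coefficient of \<open>z ^ j\<close> is an \<open>(n - j)\<close>-th finite difference of
  \<open>(x + k) ^ (n - j - 1)\<close>, which vanishes unless \<open>j = n\<close>. The quotient
  \<open>(x + k) ^ k / (x + k)\<close> stands for the power with exponent \<open>k - 1\<close>, which is negative
  at \<open>k = 0\<close>.\<close>

lemma abel_binomial:
  fixes x y :: "'a::field"
  assumes nz: "\<And>k. k \<le> n \<Longrightarrow> x + of_nat k \<noteq> 0"
  shows "(\<Sum>k\<le>n. of_nat (n choose k) * ((x + of_nat k) ^ k / (x + of_nat k)) * (y + of_nat (n - k)) ^ (n - k))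
           = (x + y + of_nat n) ^ n / x"
proof -
  define z where "z = x + y + of_nat n"
  define g where "g = (\<lambda>k j. of_nat (n choose j) * z ^ j *
      (of_nat ((n - j) choose k) * (-1) ^ (n - j - k) * ((x + of_nat k) ^ (n - j) / (x + of_nat k))))"
  have term_eq: "of_nat (n choose k) * ((x + of_nat k) ^ k / (x + of_nat k)) * (y + of_nat (n - k)) ^ (n - k)
      = (\<Sum>j\<le>n - k. g k j)" if "k \<le> n" for k
  proof -
    have "y + of_nat (n - k) = z + - (x + of_nat k)"
      using that by (simp add: z_def of_nat_diff)
    then have "(y + of_nat (n - k)) ^ (n - k)
        = (\<Sum>j\<le>n - k. of_nat ((n - k) choose j) * z ^ j * (- (x + of_nat k)) ^ (n - k - j))"
      by (simp only: binomial_ring)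
    also have "of_nat (n choose k) * ((x + of_nat k) ^ k / (x + of_nat k)) * \<dots> = (\<Sum>j\<le>n - k. g k j)"
      unfolding sum_distrib_left
    proof (rule sum.cong[OF refl])
      fix j assume j: "j \<in> {..n - k}"
      \<comment> \<open>Both sides count disjoint choices of \<open>k\<close> and of \<open>j\<close> elements.\<close>
      have c: "(n choose k) * ((n - k) choose j) = (n choose j) * ((n - j) choose k)"
      proof -
        have "real ((n choose k) * ((n - k) choose j)) = real ((n choose j) * ((n - j) choose k))"
          using j that by (simp add: binomial_fact field_simps add.commute)
        then show ?thesis by (simp only: of_nat_eq_iff)
      qed
      have e: "n - j = k + (n - k - j)" and e2: "n - j - k = n - k - j" using j that by auto
      have "of_nat (n choose k) * ((x + of_nat k) ^ k / (x + of_nat k)) *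
            (of_nat ((n - k) choose j) * z ^ j * (- (x + of_nat k)) ^ (n - k - j))
          = of_nat ((n choose k) * ((n - k) choose j)) * z ^ j * (-1) ^ (n - k - j) *
            ((x + of_nat k) ^ (k + (n - k - j)) / (x + of_nat k))"
        by (simp only: power_add power_minus[of "x + of_nat k"] of_nat_mult times_divide_eq_left
            times_divide_eq_right mult_ac)
      then show "of_nat (n choose k) * ((x + of_nat k) ^ k / (x + of_nat k)) *
            (of_nat ((n - k) choose j) * z ^ j * (- (x + of_nat k)) ^ (n - k - j)) = g k j"
        unfolding c g_def e2 by (simp only: of_nat_mult mult_ac flip: e)
    qed
    finally show ?thesis .
  qed
  have inner: "(\<Sum>k\<le>n - j. g k j) = (if j = n then z ^ n / x else 0)" if j: "j \<le> n" for j
  proof (cases "j = n")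
    case False
    define N where "N = n - j"
    have N: "N > 0" using False j N_def by simp
    have "(\<Sum>k\<le>N. of_nat (N choose k) * (-1) ^ (N - k) * ((x + of_nat k) ^ N / (x + of_nat k)))
        = (\<Sum>k\<le>N. (-1) ^ N * ((-1) ^ k * of_nat (N choose k) * (x + of_nat k) ^ (N - 1)))"
    proof (rule sum.cong[OF refl])
      fix k assume k: "k \<in> {..N}"
      have "(x + of_nat k) ^ N / (x + of_nat k) = (x + of_nat k) ^ (N - 1)"
        using N nz[of k] k unfolding N_def[symmetric] by (cases N) (auto simp: N_def)
      moreover have "(-1) ^ (N - k) = (-1) ^ N * (-1 :: 'a) ^ k"
        using k by (simp add: power_diff uminus_power_if)
      ultimately show "of_nat (N choose k) * (-1) ^ (N - k) * ((x + of_nat k) ^ N / (x + of_nat k))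
          = (-1) ^ N * ((-1) ^ k * of_nat (N choose k) * (x + of_nat k) ^ (N - 1))"
        by simp
    qed
    also have "\<dots> = 0"
      unfolding sum_distrib_left[symmetric]
      using N alternating_binomial_sum_power_eq_0[of "N - 1" N x] by simp
    finally show ?thesis
      unfolding g_def N_def[symmetric] sum_distrib_left[symmetric] using False by simp
  qed (simp add: g_def)
  have "(\<Sum>k\<le>n. of_nat (n choose k) * ((x + of_nat k) ^ k / (x + of_nat k)) * (y + of_nat (n - k)) ^ (n - k))
      = (\<Sum>k\<le>n. \<Sum>j\<le>n - k. g k j)"
    by (rule sum.cong[OF refl], rule term_eq) simp
  also have "\<dots> = (\<Sum>j\<le>n. \<Sum>k\<le>n - j. g k j)"
    by (simp add: sum.Sigma) (rule sum.reindex_bij_witness[of _ prod.swap prod.swap], auto)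
  also have "\<dots> = z ^ n / x"
    by (simp add: inner)
  finally show ?thesis unfolding z_def .
qed

text \<open>Writing \<open>x + y + n\<close> as \<open>(x + k) + (y + (n - k))\<close> raises one of the two exponents by one,
  and so splits the sum into two instances of the one-sided identity.\<close>

lemma abel_binomial_symmetric:
  fixes x y :: "'a::field"
  assumes x: "\<And>k. k \<le> n \<Longrightarrow> x + of_nat k \<noteq> 0"
    and y: "\<And>k. k \<le> n \<Longrightarrow> y + of_nat k \<noteq> 0"
  shows "(x + y + of_nat n) * (\<Sum>k\<le>n. of_nat (n choose k) * ((x + of_nat k) ^ k / (x + of_nat k))
             * ((y + of_nat (n - k)) ^ (n - k) / (y + of_nat (n - k))))
           = (1 / x + 1 / y) * (x + y + of_nat n) ^ n"
proof -
  let ?p = "\<lambda>x k. (x + of_nat k) ^ k :: 'a" and ?q = "\<lambda>x k. (x + of_nat k) ^ k / (x + of_nat k) :: 'a"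
  have "(x + y + of_nat n) * (\<Sum>k\<le>n. of_nat (n choose k) * ?q x k * ?q y (n - k))
      = (\<Sum>k\<le>n. of_nat (n choose k) * ?q x k * ?p y (n - k))
        + (\<Sum>k\<le>n. of_nat (n choose k) * ?p x k * ?q y (n - k))"
    unfolding sum_distrib_left sum.distrib[symmetric]
  proof (rule sum.cong[OF refl])
    fix k assume k: "k \<in> {..n}"
    have n: "x + y + of_nat n = (x + of_nat k) + (y + of_nat (n - k))"
      using k by (simp add: of_nat_diff)
    have *: "(x + of_nat k) * ?q x k = ?p x k" "(y + of_nat (n - k)) * ?q y (n - k) = ?p y (n - k)"
      using x[of k] y[of "n - k"] k by simp_all
    have "(u + v) * (c * a * b) = c * a * (v * b) + c * (u * a) * b" for u v c a b :: 'a
      by (simp add: algebra_simps)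
    from this[of "x + of_nat k" "y + of_nat (n - k)" "of_nat (n choose k)" "?q x k" "?q y (n - k)"]
    show "(x + y + of_nat n) * (of_nat (n choose k) * ?q x k * ?q y (n - k))
        = of_nat (n choose k) * ?q x k * ?p y (n - k) + of_nat (n choose k) * ?p x k * ?q y (n - k)"
      unfolding n * .
  qed
  also have "(\<Sum>k\<le>n. of_nat (n choose k) * ?p x k * ?q y (n - k))
      = (\<Sum>k\<le>n. of_nat (n choose k) * ?q y k * ?p x (n - k))"
    by (rule sum.reindex_bij_witness[of _ "\<lambda>k. n - k" "\<lambda>k. n - k"])
      (auto simp: binomial_symmetric[symmetric] mult_ac)
  finally show ?thesis
    using abel_binomial[of n x y, OF x] abel_binomial[of n y x, OF y]
    by (simp add: add_ac add_divide_distrib distrib_right)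
qed

section \<open>The weight of a cycle\<close>

text \<open>An \<open>m\<close>-cycle has \<open>m ^ (m - 2)\<close> factorisations into \<open>m - 1\<close> transpositions; dividing
  by \<open>(m - 1)!\<close> discards the order of the factors, as in an exponential generating function,
  so that the weights of disjoint cycles multiply. The integer exponent makes a fixed point
  weigh 1.\<close>

definition cycle_weight :: "nat \<Rightarrow> real" where
  "cycle_weight m = real m powi (int m - 2) / fact (m - 1)"

lemma cycle_weight_pos: "m > 0 \<Longrightarrow> cycle_weight m > 0"
  by (simp add: cycle_weight_def)

lemma cycle_weight_1 [simp]: "cycle_weight (Suc 0) = 1"
  by (simp add: cycle_weight_def)

text \<open>This is the symmetric Abel identity at \<open>x = y = 1\<close> and \<open>n = m - 2\<close>. It expresses that
  cutting an \<open>m\<close>-cycle into two cycles in all possible ways reproduces its own weight up to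
  a factor, which is what makes the product formula solve the recursion for path counts.\<close>

lemma cycle_weight_convolution:
  assumes "m > 0"
  shows "real m * (\<Sum>k\<in>{1..<m}. cycle_weight k * cycle_weight (m - k))
           = 2 * (real m - 1) * cycle_weight m"
proof (cases "m = 1")
  case False
  with assms obtain n where m: "m = n + 2" by (metis One_nat_def add_2_eq_Suc' not0_implies_Suc not_gr_zero)
  let ?q = "\<lambda>k. (1 + real k) ^ k / (1 + real k)"
  have weight: "cycle_weight (Suc k) = ?q k / fact k" for k
    by (simp add: cycle_weight_def power_int_diff power_int_add field_simps)
  have "(\<Sum>k\<in>{1..<m}. cycle_weight k * cycle_weight (m - k))
      = (\<Sum>k\<le>n. cycle_weight (Suc k) * cycle_weight (Suc (n - k)))"
    unfolding m by (rule sum.reindex_bij_witness[of _ Suc "\<lambda>k. k - 1"]) (auto simp: Suc_diff_le)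
  also have "\<dots> = (\<Sum>k\<le>n. real (n choose k) * ?q k * ?q (n - k)) / fact n"
    unfolding sum_divide_distrib
    by (rule sum.cong) (auto simp: weight binomial_fact of_nat_diff)
  finally have "real m * (\<Sum>k\<in>{1..<m}. cycle_weight k * cycle_weight (m - k)) = 2 * real m ^ n / fact n"
    using abel_binomial_symmetric[of n "1::real" 1] m by (simp add: add_ac)
  also have "\<dots> = 2 * (real m - 1) * cycle_weight m"
  proof -
    have "(2 + 2 * real n) * b / ((1 + real n) * a) = 2 * b / a" for a b
    proof -
      have "2 + 2 * real n = 2 * (1 + real n)" by simp
      then show ?thesis by (simp only: mult.assoc) (simp add: mult.left_commute)
    qed
    then show ?thesis by (simp add: m cycle_weight_def power_int_add)
  qed
  finally show ?thesis .
qed simp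

section \<open>Cycles of a permutation times a transposition\<close>

lemma funpow_eq_sequence:
  assumes "\<And>i. i < l \<Longrightarrow> h (c i) = c (Suc i)" and "i \<le> l"
  shows "(h ^^ i) (c 0) = c i"
  using assms(2) by (induction i) (auto simp: assms(1))

text \<open>Lets a cycle be read off from an explicit list of its points in cyclic order.\<close>

lemma orbit_eq_closed_sequence:
  assumes "\<And>i. i < l \<Longrightarrow> h (c i) = c (Suc i)" and "0 < l" and "c l = c 0"
  shows "orbit h (c 0) = c ` {..<l}"
proof -
  have "(h ^^ l) (c 0) = c 0"
    using funpow_eq_sequence[of l h c l] assms by simp
  then have "orbit h (c 0) = {(h ^^ i) (c 0) | i. i < l}"
    using \<open>0 < l\<close> by (rule orbit_altdef_bounded)
  also have "\<dots> = {c i | i. i < l}"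
    using funpow_eq_sequence[of l h c] assms(1) by (metis less_imp_le)
  finally show ?thesis by auto
qed

lemma permutation_orbit_enumeration:
  assumes "permutation f"
  shows "orbit f x = (\<lambda>i. (f ^^ i) x) ` {..<card (orbit f x)}"
    and "inj_on (\<lambda>i. (f ^^ i) x) {..<card (orbit f x)}"
    and "(f ^^ card (orbit f x)) x = x"
proof -
  have x: "x \<in> orbit f x" using assms by (rule permutation_self_in_orbit)
  define m where "m = funpow_dist1 f x x"
  have orb: "orbit f x = (\<lambda>i. (f ^^ i) x) ` {..<m}"
    using orbit_conv_funpow_dist1[OF x] by (simp add: m_def atLeast0LessThan)
  have inj: "inj_on (\<lambda>i. (f ^^ i) x) {..<m}"
    using inj_on_funpow_dist1[OF x] by (simp add: m_def atLeast0LessThan)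
  have "card (orbit f x) = m"
    by (simp add: orb card_image[OF inj])
  moreover have "(f ^^ m) x = x"
    unfolding m_def using funpow_dist1_prop[OF x] .
  ultimately show "orbit f x = (\<lambda>i. (f ^^ i) x) ` {..<card (orbit f x)}"
    and "inj_on (\<lambda>i. (f ^^ i) x) {..<card (orbit f x)}"
    and "(f ^^ card (orbit f x)) x = x"
    using orb inj by auto
qed

lemma orbit_eq_iff_mem:
  assumes "permutation f"
  shows "orbit f y = orbit f x \<longleftrightarrow> y \<in> orbit f x"
  using assms by (metis cyclic_on_orbit' orbit_cyclic_eq3 permutation_self_in_orbit)

lemma orbit_comp_transpose_outside:
  assumes "permutation f" and "a \<notin> orbit f x" and "b \<notin> orbit f x"
  shows "orbit (f \<circ> Transposition.transpose a b) x = orbit f x"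
proof (rule orbit_cong[OF permutation_self_in_orbit[OF assms(1)]])
  fix y assume "y \<in> orbit f x"
  with assms(2,3) show "(f \<circ> Transposition.transpose a b) y = f y"
    by (metis comp_apply transpose_apply_other)
qed

text \<open>Write the cycle of \<open>a\<close> as \<open>a, f a, \<dots>, b = f\<^sup>k a, \<dots>\<close>. After swapping \<open>a\<close> and \<open>b\<close> first,
  \<open>b\<close> is sent to \<open>f a\<close> and \<open>a\<close> to \<open>f b\<close>, so the points with exponents \<open>1, \<dots>, k\<close> close up to
  the cycle of \<open>b\<close> and the others to the cycle of \<open>a\<close>. Cycles elsewhere do not change.\<close>

lemma orbits_split:
  fixes f :: "'a \<Rightarrow> 'a" and k :: nat
  assumes f: "f permutes S" "finite S" and a: "a \<in> S" and k: "0 < k" "k < card (orbit f a)"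
  defines "b \<equiv> (f ^^ k) a"
  defines "g \<equiv> f \<circ> Transposition.transpose a b"
  shows "orbit g a \<union> orbit g b = orbit f a"
    and "orbit g a \<inter> orbit g b = {}"
    and "card (orbit g a) = card (orbit f a) - k"
    and "card (orbit g b) = k"
    and "orbit g ` S = orbit f ` S - {orbit f a} \<union> {orbit g a, orbit g b}"
    and "orbit g a \<notin> orbit f ` S - {orbit f a}"
    and "orbit g b \<notin> orbit f ` S - {orbit f a}"
proof -
  define P where "P = (\<lambda>i. (f ^^ i) a)"
  define m where "m = card (orbit f a)"
  have perm: "permutation f" using f by (auto simp: permutation_permutes)
  note enum = permutation_orbit_enumeration[OF perm, of a, folded m_def P_def]
  have Pinj: "P i = P j \<longleftrightarrow> i = j" if "i < m" "j < m" for i j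
    using enum(2) that by (auto simp: inj_on_def)
  have Pm: "P m = P 0" and P0: "P 0 = a" using enum(3) by (simp_all add: P_def)
  have Pk: "P k = b" and PSuc: "f (P i) = P (Suc i)" for i by (simp_all add: P_def b_def)
  have km: "k < m" using k m_def by simp
  have ab: "a \<noteq> b" using Pinj[of 0 k] P0 Pk k km by auto
  have g_a: "g a = P (Suc k)" and g_b: "g b = P 1"
    using PSuc[of k] PSuc[of 0] by (simp_all add: g_def Pk P0)
  have g_P: "g (P i) = P (Suc i)" if "0 < i" "i < m" "i \<noteq> k" for i
    using Pinj[of i 0] Pinj[of i k] that km P0 Pk PSuc by (auto simp: g_def)
  \<comment> \<open>\<open>P k\<close> is \<open>b\<close>, so the image of \<open>{0<..k}\<close> lists the cycle of \<open>b\<close> ending at \<open>b\<close>.\<close>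
  have orb_b: "orbit g b = P ` {0<..k}"
  proof -
    let ?c = "\<lambda>i. if i = 0 then b else P i"
    have "orbit g (?c 0) = ?c ` {..<k}"
      using k km by (intro orbit_eq_closed_sequence) (auto simp: g_b g_P Pk)
    also have "\<dots> = P ` {0<..k}"
    proof (intro subset_antisym subsetI)
      fix y assume "y \<in> P ` {0<..k}"
      then obtain i where "y = P i" "0 < i" "i \<le> k" by auto
      then show "y \<in> ?c ` {..<k}"
        using k(1) Pk by (intro image_eqI[of _ _ "if i = k then 0 else i"]) auto
    qed (use k(1) Pk in auto)
    finally show ?thesis by simp
  qed
  have orb_a: "orbit g a = P ` ({0} \<union> {k<..<m})"
  proof -
    let ?c = "\<lambda>i. if i = 0 then a else P (k + i)"
    have "orbit g (?c 0) = ?c ` {..<m - k}"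
      using k km Pm P0 by (intro orbit_eq_closed_sequence) (auto simp: g_a g_P)
    also have "\<dots> = P ` ({0} \<union> {k<..<m})"
    proof (intro subset_antisym subsetI)
      fix y assume "y \<in> P ` ({0} \<union> {k<..<m})"
      then obtain i where i: "y = P i" "i = 0 \<or> (k < i \<and> i < m)" by auto
      then show "y \<in> ?c ` {..<m - k}"
        using km P0 by (intro image_eqI[of _ _ "if i = 0 then 0 else i - k"]) (auto split: if_splits)
    qed (use P0 in auto)
    finally show ?thesis by simp
  qed
  have sets: "({0} \<union> {k<..<m}) \<union> {0<..k} = {..<m}" "({0} \<union> {k<..<m}) \<inter> {0<..k} = {}"
    using km by auto
  show un: "orbit g a \<union> orbit g b = orbit f a"
    unfolding orb_a orb_b enum(1) image_Un[symmetric] sets ..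
  show disj: "orbit g a \<inter> orbit g b = {}"
    unfolding orb_a orb_b using sets enum(2)
    by (subst inj_on_image_Int[OF enum(2), symmetric]) auto
  have cards: "card (P ` I) = card I" if "I \<subseteq> {..<m}" for I
    using inj_on_subset[OF enum(2) that] by (rule card_image)
  show "card (orbit g b) = k"
    unfolding orb_b using km by (subst cards) auto
  have "card ({0} \<union> {k<..<m}) = m - k"
    using km by (subst card_Un_disjoint) auto
  then show "card (orbit g a) = card (orbit f a) - k"
    unfolding orb_a using km m_def by (subst cards) auto
  have "b \<in> S"
    using permutes_orbit_subset[OF f(1) a] un permutation_self_in_orbit[of g b] enum(1) Pk km by auto
  have perm_g: "permutation g"
    using perm by (simp add: g_def permutation_compose permutation_swap_id)
  have b_orb: "b \<in> orbit f a" using enum(1) Pk km by auto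
  have inside: "orbit g x \<in> {orbit g a, orbit g b}" if "x \<in> orbit f a" for x
    using that un orbit_eq_iff_mem[OF perm_g] by auto
  have outside: "orbit g x = orbit f x" if "x \<notin> orbit f a" for x
    unfolding g_def
    using that b_orb orbit_eq_iff_mem[OF perm] permutation_self_in_orbit[OF perm]
    by (intro orbit_comp_transpose_outside[OF perm]) metis+
  show "orbit g ` S = orbit f ` S - {orbit f a} \<union> {orbit g a, orbit g b}"
  proof (intro subset_antisym subsetI)
    fix C assume "C \<in> orbit g ` S"
    then obtain x where x: "x \<in> S" "C = orbit g x" by auto
    show "C \<in> orbit f ` S - {orbit f a} \<union> {orbit g a, orbit g b}"
    proof (cases "x \<in> orbit f a")
      case False
      then have "orbit f x \<noteq> orbit f a" using orbit_eq_iff_mem[OF perm] by blast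
      with False outside x show ?thesis by auto
    qed (use inside x in auto)
  next
    fix C assume C: "C \<in> orbit f ` S - {orbit f a} \<union> {orbit g a, orbit g b}"
    show "C \<in> orbit g ` S"
    proof (cases "C \<in> {orbit g a, orbit g b}")
      case False
      with C obtain x where x: "x \<in> S" "C = orbit f x" "orbit f x \<noteq> orbit f a" by auto
      then have "x \<notin> orbit f a" using orbit_eq_iff_mem[OF perm] by blast
      with outside x have "C = orbit g x" by simp
      with x(1) show ?thesis by blast
    qed (use a \<open>b \<in> S\<close> in auto)
  qed
  have notin: "D \<notin> orbit f ` S - {orbit f a}" if D: "D \<subseteq> orbit f a" "D \<noteq> {}" for D
  proof
    assume "D \<in> orbit f ` S - {orbit f a}"
    then obtain x where x: "D = orbit f x" "orbit f x \<noteq> orbit f a" by auto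
    with D permutation_self_in_orbit[OF perm, of x] have "x \<in> orbit f a" by auto
    with x show False using orbit_eq_iff_mem[OF perm] by blast
  qed
  show "orbit g a \<notin> orbit f ` S - {orbit f a}" "orbit g b \<notin> orbit f ` S - {orbit f a}"
    using un by (intro notin orbit_nonempty; blast)+
qed

lemma mem_orbit_funpow_less:
  assumes "permutation f" "b \<in> orbit f a" "a \<noteq> b"
  obtains k where "0 < k" "k < card (orbit f a)" "b = (f ^^ k) a"
proof -
  from permutation_orbit_enumeration(1)[OF assms(1)] assms(2)
  obtain k where k: "k < card (orbit f a)" "b = (f ^^ k) a" by blast
  with assms(3) have "0 < k" by (cases k) auto
  with k show ?thesis using that by blast
qed

lemma card_orbits_split:
  assumes f: "f permutes S" "finite S" and ab: "a \<in> S" "a \<noteq> b" "b \<in> orbit f a"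
  shows "card (orbit (f \<circ> Transposition.transpose a b) ` S) = Suc (card (orbit f ` S))"
proof -
  have perm: "permutation f" using f by (auto simp: permutation_permutes)
  obtain k where k: "0 < k" "k < card (orbit f a)" "b = (f ^^ k) a"
    using mem_orbit_funpow_less[OF perm ab(3,2)] .
  let ?g = "f \<circ> Transposition.transpose a b"
  note split = orbits_split[OF f ab(1) k(1,2), folded k(3)]
  have perm_g: "permutation ?g"
    using perm by (simp add: permutation_compose permutation_swap_id)
  have neq: "orbit ?g a \<noteq> orbit ?g b"
    using split(2) orbit_nonempty[of ?g a] by auto
  have "orbit f a \<in> orbit f ` S" using ab(1) by auto
  moreover have "card (orbit f ` S) > 0"
    using f(2) ab(1) by (auto simp: card_gt_0_iff)
  ultimately show ?thesis
    unfolding split(5) using neq f(2) split(6,7) by (simp add: card_Diff_singleton)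
qed

text \<open>If \<open>a\<close> and \<open>b\<close> lie in different cycles, then \<open>a\<close> is sent to \<open>f b\<close> and from there runs
  through the whole old cycle of \<open>b\<close> until it reaches \<open>b\<close>. Since the product with the
  transposition is undone by the same transposition, everything else about merging is
  splitting read backwards.\<close>

lemma mem_orbit_merge:
  assumes f: "permutation f" and b: "b \<notin> orbit f a"
  shows "b \<in> orbit (f \<circ> Transposition.transpose a b) a"
proof -
  let ?g = "f \<circ> Transposition.transpose a b"
  note enum = permutation_orbit_enumeration[OF f, of b]
  define m where "m = card (orbit f b)"
  have a: "a \<notin> orbit f b"
    using b orbit_eq_iff_mem[OF f] permutation_self_in_orbit[OF f] by metis
  have "m > 0" using finite_orbit[OF permutation_self_in_orbit[OF f]] orbit_nonempty[of f b]
    by (simp add: m_def card_gt_0_iff)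
  let ?c = "\<lambda>i. if i = 0 then a else (f ^^ i) b"
  have "(?g ^^ m) (?c 0) = ?c m"
  proof (rule funpow_eq_sequence[where l = m])
    fix i assume i: "i < m"
    show "?g (?c i) = ?c (Suc i)"
    proof (cases "i = 0")
      case False
      have "(f ^^ i) b \<noteq> b"
        using inj_onD[OF enum(2), of i 0] False i by (auto simp: m_def)
      moreover have "(f ^^ i) b \<noteq> a"
        using a enum(1) i by (auto simp: m_def)
      ultimately show ?thesis using False by simp
    qed simp
  qed simp
  then have "(?g ^^ m) a = b"
    using \<open>m > 0\<close> enum(3) by (simp add: m_def)
  then show ?thesis
    using \<open>m > 0\<close> funpow_in_orbit[of _ ?g]
    by (metis (mono_tags, lifting) mem_Collect_eq orbit_altdef)
qed

lemma comp_transpose_cancel [simp]: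
  "f \<circ> Transposition.transpose a b \<circ> Transposition.transpose a b = f"
  by (simp add: comp_assoc)

lemma card_orbits_merge:
  assumes f: "f permutes S" "finite S" and ab: "a \<in> S" "b \<in> S" "b \<notin> orbit f a"
  shows "Suc (card (orbit (f \<circ> Transposition.transpose a b) ` S)) = card (orbit f ` S)"
proof -
  have perm: "permutation f" using f by (auto simp: permutation_permutes)
  let ?g = "f \<circ> Transposition.transpose a b"
  have "?g permutes S"
    using f ab by (intro permutes_compose permutes_swap_id)
  moreover have "a \<noteq> b" using ab(3) permutation_self_in_orbit[OF perm] by auto
  ultimately show ?thesis
    using card_orbits_split[of ?g S a b] f(2) ab mem_orbit_merge[OF perm ab(3)] by simp
qed

lemma orbit_merge_mono:
  assumes f: "f permutes S" "finite S" and ab: "a \<in> S" "b \<in> S" "b \<notin> orbit f a"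
  shows "orbit f x \<subseteq> orbit (f \<circ> Transposition.transpose a b) x"
proof -
  let ?g = "f \<circ> Transposition.transpose a b"
  have perm: "permutation f" using f by (auto simp: permutation_permutes)
  have g: "?g permutes S" using f ab by (intro permutes_compose permutes_swap_id)
  then have perm_g: "permutation ?g" using f by (auto simp: permutation_permutes)
  have "a \<noteq> b" using ab(3) permutation_self_in_orbit[OF perm] by auto
  then obtain k where k: "0 < k" "k < card (orbit ?g a)" "b = (?g ^^ k) a"
    using mem_orbit_funpow_less[OF perm_g mem_orbit_merge[OF perm ab(3)]] by blast
  have un: "orbit f a \<union> orbit f b = orbit ?g a"
    using orbits_split(1)[OF g f(2) ab(1) k(1,2)] k(3) by simp
  show ?thesis
  proof (cases "a \<in> orbit f x \<or> b \<in> orbit f x")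
    case True
    then have x: "orbit f x = orbit f a \<or> orbit f x = orbit f b"
      using orbit_eq_iff_mem[OF perm] by metis
    then have "x \<in> orbit ?g a" using un permutation_self_in_orbit[OF perm, of x] by auto
    then have "orbit ?g x = orbit ?g a" using orbit_eq_iff_mem[OF perm_g] by blast
    with x un show ?thesis by auto
  next
    case False
    then show ?thesis using orbit_comp_transpose_outside[OF perm] by simp
  qed
qed

lemma prod_orbits_split:
  fixes F :: "nat \<Rightarrow> 'b::comm_monoid_mult"
  assumes f: "f permutes S" "finite S" and a: "a \<in> S" and k: "0 < k" "k < card (orbit f a)"
  shows "(\<Prod>C\<in>orbit (f \<circ> Transposition.transpose a ((f ^^ k) a)) ` S. F (card C))
           = F k * F (card (orbit f a) - k) * (\<Prod>C\<in>orbit f ` S - {orbit f a}. F (card C))"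
proof -
  let ?b = "(f ^^ k) a"
  let ?g = "f \<circ> Transposition.transpose a ?b"
  note split = orbits_split[OF f a k]
  have neq: "orbit ?g a \<noteq> orbit ?g ?b"
    using split(2) orbit_nonempty[of ?g a] by auto
  have "orbit ?g ` S = insert (orbit ?g ?b) (insert (orbit ?g a) (orbit f ` S - {orbit f a}))"
    unfolding split(5) by blast
  then show ?thesis
    using neq f(2) split(6,7) by (simp add: split(3,4) mult.assoc)
qed

text \<open>The points of a cycle of length \<open>m\<close> contribute \<open>m\<close> times \<open>1 / m\<close>, so each cycle is
  counted once.\<close>

lemma sum_inverse_card_orbit:
  assumes f: "f permutes S" "finite S"
  shows "(\<Sum>a\<in>S. 1 / real (card (orbit f a))) = real (card (orbit f ` S))"
proof -
  have perm: "permutation f" using f by (auto simp: permutation_permutes)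
  have fibre: "{a \<in> S. orbit f a = C} = C" if "C \<in> orbit f ` S" for C
    using that orbit_eq_iff_mem[OF perm] permutes_orbit_subset[OF f(1)] by blast
  have "(\<Sum>a\<in>S. 1 / real (card (orbit f a)))
      = (\<Sum>C\<in>orbit f ` S. \<Sum>a\<in>{a \<in> S. orbit f a = C}. 1 / real (card (orbit f a)))"
    by (rule sum.image_gen[OF f(2)])
  also have "\<dots> = (\<Sum>C\<in>orbit f ` S. 1)"
  proof (rule sum.cong[OF refl])
    fix C assume C: "C \<in> orbit f ` S"
    have "C \<noteq> {}" "finite C"
      using C orbit_nonempty[of f] finite_orbit[OF permutation_self_in_orbit[OF perm]] by auto
    then have "card C \<noteq> 0" by simp
    have "(\<Sum>a\<in>{a \<in> S. orbit f a = C}. 1 / real (card (orbit f a)))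
        = (\<Sum>a\<in>{a \<in> S. orbit f a = C}. 1 / real (card C))"
      by (rule sum.cong) auto
    then show "(\<Sum>a\<in>{a \<in> S. orbit f a = C}. 1 / real (card (orbit f a))) = 1"
      using \<open>card C \<noteq> 0\<close> by (simp add: fibre[OF C])
  qed
  finally show ?thesis by simp
qed

section \<open>Counting paths by their last step\<close>

lemma paths_0: "paths E 0 u v = (if u = v then {[u]} else {})"
  by (auto simp: paths_def length_Suc_conv)

lemma paths_Suc:
  "paths E (Suc k) u v = (\<Union>w\<in>{w. E w v}. (\<lambda>p. p @ [v]) ` paths E k u w)"
proof (intro subset_antisym subsetI)
  fix p assume p: "p \<in> paths E (Suc k) u v"
  then have "p \<noteq> []" by (auto simp: paths_def)
  define q where "q = butlast p"
  have pq: "p = q @ [v]"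
    using p append_butlast_last_id[OF \<open>p \<noteq> []\<close>] by (auto simp: paths_def q_def)
  have "length q = Suc k"
    using p by (simp add: paths_def q_def)
  then have "q \<noteq> []" by auto
  with pq have "E (last q) v" "q \<in> paths E k u (last q)"
    using p by (auto simp: paths_def successively_append_iff)
  with pq show "p \<in> (\<Union>w\<in>{w. E w v}. (\<lambda>p. p @ [v]) ` paths E k u w)" by blast
qed (auto simp: paths_def successively_append_iff hd_append)

lemma finite_paths:
  assumes "\<And>v. finite {w. E w v}"
  shows "finite (paths E k u v)"
  by (induction k arbitrary: v) (auto simp: paths_0 paths_Suc assms)

lemma card_paths_Suc:
  assumes fin: "\<And>v. finite {w. E w v}"
  shows "card (paths E (Suc k) u v) = (\<Sum>w | E w v. card (paths E k u w))"
proof -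
  note finite = finite_paths[OF fin]
  have "card (paths E (Suc k) u v) = (\<Sum>w | E w v. card ((\<lambda>p. p @ [v]) ` paths E k u w))"
    unfolding paths_Suc
    by (rule card_UN_disjoint) (auto simp: fin finite, auto simp: paths_def)
  also have "\<dots> = (\<Sum>w | E w v. card (paths E k u w))"
    by (intro sum.cong refl card_image) (auto simp: inj_on_def)
  finally show ?thesis .
qed

lemma transpositionsE:
  assumes "\<tau> \<in> transpositions n"
  obtains a b where "\<tau> = Transposition.transpose a b" "a \<in> {1..n}" "b \<in> {1..n}" "a \<noteq> b"
  using assms by (auto simp: transpositions_def)

lemma finite_perms: "finite (perms n)"
  unfolding perms_def by (rule finite_permutations) simp

lemma finite_transpositions: "finite (transpositions n)"
proof -
  have "transpositions n \<subseteq> (\<lambda>(a, b). Transposition.transpose a b) ` ({1..n} \<times> {1..n})"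
    by (auto simp: transpositions_def)
  then show ?thesis by (rule finite_subset) simp
qed

lemma comp_transposition_in_perms:
  "\<sigma> \<in> perms n \<Longrightarrow> \<tau> \<in> transpositions n \<Longrightarrow> \<sigma> \<circ> \<tau> \<in> perms n"
  by (elim transpositionsE) (auto simp: perms_def intro!: permutes_compose permutes_swap_id)

lemma comp_transposition_cancel:
  "\<tau> \<in> transpositions n \<Longrightarrow> \<sigma> \<circ> \<tau> \<circ> \<tau> = \<sigma>"
  by (elim transpositionsE) (simp del: comp_apply)

lemma inj_on_comp_perm: "\<sigma> \<in> perms n \<Longrightarrow> inj_on ((\<circ>) \<sigma>) X"
  unfolding perms_def inj_on_def by (metis comp_assoc id_comp mem_Collect_eq permutes_inv_o(2))

lemma finite_cayley_predecessors: "finite {\<rho>. cayley_adj n \<rho> \<sigma>}"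
  by (rule finite_subset[OF _ finite_perms[of n]]) (auto simp: cayley_adj_def)

text \<open>Transpositions are involutions, so the predecessors of \<open>\<sigma>\<close> are its neighbours
  \<open>\<sigma> \<circ> \<tau>\<close>, one for each transposition.\<close>

lemma card_cayley_paths_Suc:
  assumes \<sigma>: "\<sigma> \<in> perms n"
  shows "card (paths (cayley_adj n) (Suc k) id \<sigma>)
           = (\<Sum>\<tau>\<in>transpositions n. card (paths (cayley_adj n) k id (\<sigma> \<circ> \<tau>)))"
proof -
  have "card (paths (cayley_adj n) (Suc k) id \<sigma>)
      = (\<Sum>\<rho> | cayley_adj n \<rho> \<sigma>. card (paths (cayley_adj n) k id \<rho>))"
    by (rule card_paths_Suc[OF finite_cayley_predecessors])
  also have "{\<rho>. cayley_adj n \<rho> \<sigma>} = (\<circ>) \<sigma> ` transpositions n"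
  proof (intro subset_antisym subsetI)
    fix \<rho> assume "\<rho> \<in> {\<rho>. cayley_adj n \<rho> \<sigma>}"
    then obtain \<tau> where "\<tau> \<in> transpositions n" "\<sigma> = \<rho> \<circ> \<tau>"
      by (auto simp: cayley_adj_def)
    then show "\<rho> \<in> (\<circ>) \<sigma> ` transpositions n"
      using comp_transposition_cancel[of \<tau> n \<rho>] by (intro image_eqI[of _ _ \<tau>]) simp_all
  next
    fix \<rho> assume "\<rho> \<in> (\<circ>) \<sigma> ` transpositions n"
    then obtain \<tau> where \<tau>: "\<tau> \<in> transpositions n" "\<rho> = \<sigma> \<circ> \<tau>" by auto
    then have "\<sigma> = \<rho> \<circ> \<tau>" using comp_transposition_cancel[of \<tau> n \<sigma>] by simp
    with \<tau> \<sigma> show "\<rho> \<in> {\<rho>. cayley_adj n \<rho> \<sigma>}"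
      unfolding cayley_adj_def using comp_transposition_in_perms by blast
  qed
  also have "(\<Sum>\<rho>\<in>(\<circ>) \<sigma> ` transpositions n. card (paths (cayley_adj n) k id \<rho>))
      = (\<Sum>\<tau>\<in>transpositions n. card (paths (cayley_adj n) k id (\<sigma> \<circ> \<tau>)))"
    by (rule sum.reindex_cong[OF inj_on_comp_perm[OF \<sigma>] refl refl])
  finally show ?thesis .
qed

section \<open>Shortest paths from the identity\<close>

text \<open>The subtraction never truncates, as there are at most \<open>n\<close> cycles. The rank turns out to be
  the distance from the identity.\<close>

definition cycle_rank :: "nat \<Rightarrow> (nat \<Rightarrow> nat) \<Rightarrow> nat" where
  "cycle_rank n \<sigma> = n - card (cycles_of n \<sigma>)"

lemma card_cycles_of_le: "card (cycles_of n \<sigma>) \<le> n"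
  unfolding cycles_of_def using card_image_le[of "{1..n}" "orbit \<sigma>"] by simp

lemma cycle_rank_split:
  assumes "\<sigma> \<in> perms n" "a \<in> {1..n}" "a \<noteq> b" "b \<in> orbit \<sigma> a"
  shows "Suc (cycle_rank n (\<sigma> \<circ> Transposition.transpose a b)) = cycle_rank n \<sigma>"
  using card_orbits_split[of \<sigma> "{1..n}" a b] assms
    card_cycles_of_le[of n "\<sigma> \<circ> Transposition.transpose a b"]
  by (simp add: cycle_rank_def cycles_of_def perms_def)

lemma cycle_rank_merge:
  assumes "\<sigma> \<in> perms n" "a \<in> {1..n}" "b \<in> {1..n}" "b \<notin> orbit \<sigma> a"
  shows "cycle_rank n (\<sigma> \<circ> Transposition.transpose a b) = Suc (cycle_rank n \<sigma>)"
  using card_orbits_merge[of \<sigma> "{1..n}" a b] assms card_cycles_of_le[of n \<sigma>]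
  by (simp add: cycle_rank_def cycles_of_def perms_def)

lemma cycle_rank_comp_transposition:
  assumes "\<sigma> \<in> perms n" "\<tau> \<in> transpositions n"
  shows "cycle_rank n (\<sigma> \<circ> \<tau>) = Suc (cycle_rank n \<sigma>) \<or> Suc (cycle_rank n (\<sigma> \<circ> \<tau>)) = cycle_rank n \<sigma>"
  using assms by (elim transpositionsE) (metis cycle_rank_merge cycle_rank_split)

lemma id_in_perms [simp]: "id \<in> perms n"
  by (simp add: perms_def permutes_id)

lemma cycles_of_id: "cycles_of n id = (\<lambda>x. {x}) ` {1..n}"
proof -
  have "orbit id x = {x}" for x :: nat by (simp add: orbit_eq_singleton_iff)
  then show ?thesis by (simp add: cycles_of_def)
qed

lemma cycle_rank_eq_0_iff:
  assumes "\<sigma> \<in> perms n"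
  shows "cycle_rank n \<sigma> = 0 \<longleftrightarrow> \<sigma> = id"
proof
  assume "cycle_rank n \<sigma> = 0"
  then have "card (orbit \<sigma> ` {1..n}) = card {1..n}"
    using card_cycles_of_le[of n \<sigma>] by (simp add: cycle_rank_def cycles_of_def)
  then have inj: "inj_on (orbit \<sigma>) {1..n}" by (intro eq_card_imp_inj_on) auto
  have \<sigma>: "\<sigma> permutes {1..n}" using assms by (simp add: perms_def)
  then have perm: "permutation \<sigma>" by (auto simp: permutation_permutes)
  show "\<sigma> = id"
  proof
    fix x
    show "\<sigma> x = id x"
    proof (cases "x \<in> {1..n}")
      case True
      then show ?thesis
        using inj_onD[OF inj permutation_orbit_step[OF perm, of x]] permutes_in_image[OF \<sigma>, of x]
        by simp
    qed (use \<sigma> in \<open>auto simp: permutes_not_in\<close>)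
  qed
next
  assume "\<sigma> = id"
  then show "cycle_rank n \<sigma> = 0"
    by (simp add: cycle_rank_def cycles_of_id card_image)
qed

text \<open>The rank starts at 0 and grows by at most one in each step.\<close>

lemma no_short_cayley_paths:
  assumes "\<sigma> \<in> perms n" "k < cycle_rank n \<sigma>"
  shows "card (paths (cayley_adj n) k id \<sigma>) = 0"
  using assms
proof (induction k arbitrary: \<sigma>)
  case 0
  then show ?case using cycle_rank_eq_0_iff[of \<sigma> n] by (auto simp: paths_0)
next
  case (Suc k)
  have "card (paths (cayley_adj n) k id (\<sigma> \<circ> \<tau>)) = 0" if "\<tau> \<in> transpositions n" for \<tau>
    using cycle_rank_comp_transposition[OF Suc.prems(1) that] Suc.prems(2)
    by (intro Suc.IH comp_transposition_in_perms[OF Suc.prems(1) that]) (auto simp del: o_apply)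
  then show ?case unfolding card_cayley_paths_Suc[OF Suc.prems(1)] by simp
qed

text \<open>Summing over ordered pairs lets the first point \<open>a\<close> select a cycle and the second run
  along it; each transposition then occurs twice.\<close>

lemma sum_transpositions_ordered_pairs:
  fixes g :: "(nat \<Rightarrow> nat) \<Rightarrow> real"
  shows "2 * (\<Sum>\<tau>\<in>transpositions n. g \<tau>)
           = (\<Sum>a\<in>{1..n}. \<Sum>b\<in>{1..n} - {a}. g (Transposition.transpose a b))"
proof -
  define P where "P = (SIGMA a:{1..n}. {1..n} - {a})"
  define h where "h = (\<lambda>(a, b). Transposition.transpose a b :: nat \<Rightarrow> nat)"
  have "h ` P = transpositions n"
    unfolding transpositions_def P_def h_def by (auto simp: image_iff) blast+
  moreover have fibre: "card {p \<in> P. h p = \<tau>} = 2" if "\<tau> \<in> transpositions n" for \<tau>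
  proof -
    from that obtain a b where ab: "\<tau> = Transposition.transpose a b" "a \<in> {1..n}" "b \<in> {1..n}" "a \<noteq> b"
      by (rule transpositionsE)
    have "(c, d) = (a, b) \<or> (c, d) = (b, a)"
      if "Transposition.transpose c d = Transposition.transpose a b" "c \<noteq> d" for c d
      using fun_cong[OF that(1), of c] fun_cong[OF that(1), of d] that(2)
      by (auto simp: Transposition.transpose_def split: if_splits)
    then have "{p \<in> P. h p = \<tau>} = {(a, b), (b, a)}"
      using ab by (auto simp: P_def h_def transpose_commute)
    then show ?thesis using ab by simp
  qed
  moreover have "finite P" by (simp add: P_def)
  then have "(\<Sum>p\<in>P. g (h p)) = (\<Sum>\<tau>\<in>h ` P. \<Sum>p\<in>{p \<in> P. h p = \<tau>}. g (h p))"
    by (rule sum.image_gen)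
  moreover have "(\<Sum>p\<in>{p \<in> P. h p = \<tau>}. g (h p)) = (\<Sum>p\<in>{p \<in> P. h p = \<tau>}. g \<tau>)" for \<tau>
    by (rule sum.cong) auto
  ultimately have "(\<Sum>p\<in>P. g (h p)) = (\<Sum>\<tau>\<in>transpositions n. 2 * g \<tau>)"
    by simp
  then show ?thesis
    by (simp add: P_def h_def sum.Sigma sum_distrib_left case_prod_unfold)
qed

text \<open>By induction on the rank, counting by the last step. A last step that was taken from a
  permutation of larger rank contributes nothing, so only transpositions of two points \<open>a\<close> and
  \<open>\<sigma>\<^sup>k a\<close> of one cycle matter. If \<open>m\<close> is the length of that cycle, the induction hypothesis
  replaces its weight by \<open>cycle_weight k * cycle_weight (m - k)\<close>, and the convolution identity
  sums this over \<open>k\<close> to the old weight times \<open>2 * (1 - 1 / m)\<close>. Finally the sum of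
  \<open>1 - 1 / m\<close> over all points \<open>a\<close> is \<open>n\<close> minus the number of cycles, that is the rank, and
  supplies the next factor of the factorial.\<close>

theorem card_minimal_cayley_paths:
  assumes "\<sigma> \<in> perms n"
  shows "real (card (paths (cayley_adj n) (cycle_rank n \<sigma>) id \<sigma>))
           = fact (cycle_rank n \<sigma>) * (\<Prod>C\<in>cycles_of n \<sigma>. cycle_weight (card C))"
  using assms
proof (induction "cycle_rank n \<sigma>" arbitrary: \<sigma>)
  case 0
  then have "\<sigma> = id" using cycle_rank_eq_0_iff by simp
  moreover have "(\<Prod>C\<in>cycles_of n id. cycle_weight (card C)) = 1"
    unfolding cycles_of_id by (rule prod.neutral) auto
  ultimately show ?case
    using cycle_rank_eq_0_iff[of id n] by (simp add: paths_0 del: id_apply)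
next
  case (Suc t)
  define W where "W = (\<lambda>\<sigma>. \<Prod>C\<in>cycles_of n \<sigma>. cycle_weight (card C))"
  define N where "N = (\<lambda>\<sigma>. real (card (paths (cayley_adj n) t id \<sigma>)))"
  note \<sigma> = \<open>\<sigma> \<in> perms n\<close>
  have perm_on: "\<sigma> permutes {1..n}" using \<sigma> by (simp add: perms_def)
  then have perm: "permutation \<sigma>" by (auto simp: permutation_permutes)
  have inner: "(\<Sum>b\<in>{1..n} - {a}. N (\<sigma> \<circ> Transposition.transpose a b))
      = 2 * fact t * W \<sigma> * (1 - 1 / real (card (orbit \<sigma> a)))" if a: "a \<in> {1..n}" for a
  proof -
    define m where "m = card (orbit \<sigma> a)"
    define R where "R = (\<Prod>C\<in>cycles_of n \<sigma> - {orbit \<sigma> a}. cycle_weight (card C))"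
    note enum = permutation_orbit_enumeration[OF perm, of a, folded m_def]
    have "m > 0"
      using finite_orbit[OF permutation_self_in_orbit[OF perm]] orbit_nonempty[of \<sigma> a]
      by (simp add: m_def card_gt_0_iff)
    have W: "W \<sigma> = cycle_weight m * R"
      using a unfolding W_def R_def m_def by (intro prod.remove) (auto simp: cycles_of_def)
    \<comment> \<open>The second point of the transposition is parametrised by its position on the cycle of \<open>a\<close>.\<close>
    have bij: "bij_betw (\<lambda>k. (\<sigma> ^^ k) a) {1..<m} (orbit \<sigma> a - {a})"
    proof -
      have "bij_betw (\<lambda>k. (\<sigma> ^^ k) a) {..<m} (orbit \<sigma> a)"
        using enum by (auto simp: bij_betw_def)
      from bij_betw_DiffI[OF this, of "{0}" "{a}"] have "bij_betw (\<lambda>k. (\<sigma> ^^ k) a) ({..<m} - {0}) (orbit \<sigma> a - {a})"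
        using \<open>m > 0\<close> permutation_self_in_orbit[OF perm, of a] by (simp add: bij_betw_def)
      moreover have "{..<m} - {0} = {1..<m}" by auto
      ultimately show ?thesis by simp
    qed
    have "(\<Sum>b\<in>{1..n} - {a}. N (\<sigma> \<circ> Transposition.transpose a b))
        = (\<Sum>b\<in>orbit \<sigma> a - {a}. N (\<sigma> \<circ> Transposition.transpose a b))"
    proof (rule sum.mono_neutral_right)
      show "orbit \<sigma> a - {a} \<subseteq> {1..n} - {a}"
        using permutes_orbit_subset[OF perm_on a] by auto
      show "\<forall>b\<in>{1..n} - {a} - (orbit \<sigma> a - {a}). N (\<sigma> \<circ> Transposition.transpose a b) = 0"
      proof
        fix b assume "b \<in> {1..n} - {a} - (orbit \<sigma> a - {a})"
        then have b: "b \<in> {1..n}" "a \<noteq> b" "b \<notin> orbit \<sigma> a" by auto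
        have "\<sigma> \<circ> Transposition.transpose a b \<in> perms n"
          using a b by (intro comp_transposition_in_perms[OF \<sigma>]) (auto simp: transpositions_def)
        \<comment> \<open>Undoing a last step that joins \<open>a\<close> and \<open>b\<close> would lead to rank \<open>t + 2\<close>, out of reach in \<open>t\<close> steps.\<close>
        then show "N (\<sigma> \<circ> Transposition.transpose a b) = 0"
          using cycle_rank_merge[OF \<sigma> a b(1,3)] Suc.hyps(2) no_short_cayley_paths
          by (simp add: N_def)
      qed
    qed simp
    also have "\<dots> = (\<Sum>k\<in>{1..<m}. N (\<sigma> \<circ> Transposition.transpose a ((\<sigma> ^^ k) a)))"
      by (rule sum.reindex_bij_betw[OF bij, symmetric])
    also have "\<dots> = (\<Sum>k\<in>{1..<m}. fact t * (cycle_weight k * cycle_weight (m - k) * R))"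
    proof (rule sum.cong[OF refl])
      fix k assume k: "k \<in> {1..<m}"
      let ?b = "(\<sigma> ^^ k) a"
      have b: "?b \<in> orbit \<sigma> a" "a \<noteq> ?b"
        using bij_betwE[OF bij] k by fastforce+
      have "?b \<in> {1..n}" using permutes_orbit_subset[OF perm_on a] b by auto
      then have "\<sigma> \<circ> Transposition.transpose a ?b \<in> perms n"
        using a b by (intro comp_transposition_in_perms[OF \<sigma>]) (auto simp: transpositions_def)
      moreover have "cycle_rank n (\<sigma> \<circ> Transposition.transpose a ?b) = t"
        using cycle_rank_split[OF \<sigma> a b(2,1)] Suc.hyps(2) by simp
      ultimately have "N (\<sigma> \<circ> Transposition.transpose a ?b) = fact t * W (\<sigma> \<circ> Transposition.transpose a ?b)"
        using Suc.hyps(1)[of "\<sigma> \<circ> Transposition.transpose a ?b"]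
        unfolding N_def W_def by simp
      also have "W (\<sigma> \<circ> Transposition.transpose a ?b) = cycle_weight k * cycle_weight (m - k) * R"
        unfolding W_def R_def m_def cycles_of_def
        using k by (intro prod_orbits_split[OF perm_on _ a]) (auto simp: m_def)
      finally show "N (\<sigma> \<circ> Transposition.transpose a ?b) = fact t * (cycle_weight k * cycle_weight (m - k) * R)" .
    qed
    also have "\<dots> = fact t * R * (\<Sum>k\<in>{1..<m}. cycle_weight k * cycle_weight (m - k))"
      unfolding sum_distrib_left by (rule sum.cong) simp_all
    also have "(\<Sum>k\<in>{1..<m}. cycle_weight k * cycle_weight (m - k))
        = 2 * (real m - 1) * cycle_weight m / real m"
      unfolding cycle_weight_convolution[OF \<open>m > 0\<close>, symmetric] using \<open>m > 0\<close> by simp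
    also have "fact t * R * (2 * (real m - 1) * cycle_weight m / real m)
        = 2 * fact t * W \<sigma> * (1 - 1 / real m)"
      using \<open>m > 0\<close> by (simp add: W field_simps)
    finally show ?thesis unfolding m_def .
  qed
  have "2 * real (card (paths (cayley_adj n) (Suc t) id \<sigma>)) = 2 * (\<Sum>\<tau>\<in>transpositions n. N (\<sigma> \<circ> \<tau>))"
    by (simp add: card_cayley_paths_Suc[OF \<sigma>] N_def)
  also have "\<dots> = (\<Sum>a\<in>{1..n}. 2 * fact t * W \<sigma> * (1 - 1 / real (card (orbit \<sigma> a))))"
    unfolding sum_transpositions_ordered_pairs by (rule sum.cong[OF refl inner])
  also have "\<dots> = 2 * fact t * W \<sigma> * (real n - real (card (cycles_of n \<sigma>)))"
    unfolding sum_distrib_left[symmetric] sum_subtractf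
    using sum_inverse_card_orbit[OF perm_on] by (simp add: cycles_of_def)
  also have "real n - real (card (cycles_of n \<sigma>)) = real (Suc t)"
    using Suc.hyps(2) card_cycles_of_le[of n \<sigma>] unfolding cycle_rank_def by linarith
  also have "2 * fact t * W \<sigma> * real (Suc t) = 2 * (fact (Suc t) * W \<sigma>)"
    by simp
  finally have "real (card (paths (cayley_adj n) (Suc t) id \<sigma>)) = fact (Suc t) * W \<sigma>"
    by linarith
  then show ?case by (simp only: Suc.hyps(2)[symmetric] W_def)
qed

lemma cycle_weight_prod_pos: "(\<Prod>C\<in>cycles_of n \<sigma>. cycle_weight (card C)) > 0"
  if "\<sigma> \<in> perms n"
proof (rule prod_pos)
  fix C assume C: "C \<in> cycles_of n \<sigma>"
  have "permutation \<sigma>" using that by (auto simp: permutation_permutes perms_def)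
  then have "finite C" "C \<noteq> {}"
    using C orbit_nonempty[of \<sigma>] finite_orbit[OF permutation_self_in_orbit, of \<sigma>]
    by (auto simp: cycles_of_def)
  then show "cycle_weight (card C) > 0" by (intro cycle_weight_pos) (simp add: card_gt_0_iff)
qed

text \<open>The product formula is positive, so a path whose length is the rank exists.\<close>

lemma dist_eq_cycle_rank:
  assumes "\<sigma> \<in> perms n"
  shows "dist\<^sub>G n \<sigma> = cycle_rank n \<sigma>"
  unfolding dist\<^sub>G_def
proof (rule Least_equality)
  have "real (card (paths (cayley_adj n) (cycle_rank n \<sigma>) id \<sigma>)) > 0"
    using card_minimal_cayley_paths[OF assms] cycle_weight_prod_pos[OF assms] by simp
  then show "paths (cayley_adj n) (cycle_rank n \<sigma>) id \<sigma> \<noteq> {}" by auto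
next
  fix k assume k: "paths (cayley_adj n) k id \<sigma> \<noteq> {}"
  have "finite (paths (cayley_adj n) k id \<sigma>)"
    by (rule finite_paths[OF finite_cayley_predecessors])
  with k no_short_cayley_paths[OF assms, of k] show "cycle_rank n \<sigma> \<le> k"
    by (metis card_0_eq linorder_not_le)
qed

lemma prod_cycle_lengths:
  "(\<Prod>m\<in>#cycle_lengths n \<sigma>. F m) = (\<Prod>C\<in>cycles_of n \<sigma>. F (card C))"
  by (simp add: cycle_lengths_def prod_unfold_prod_mset image_mset.compositionality o_def)

section \<open>The random walk\<close>

text \<open>A merging step is not a fragmentation: every old cycle is contained in a new one, so an
  old cycle that contains two new ones would have to equal both.\<close>

lemma fragmentation_iff:
  assumes \<sigma>: "\<sigma> \<in> perms n" and \<tau>: "\<tau> \<in> transpositions n"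
  shows "fragmentation n \<sigma> (\<sigma> \<circ> \<tau>) \<longleftrightarrow> Suc (cycle_rank n (\<sigma> \<circ> \<tau>)) = cycle_rank n \<sigma>"
proof -
  obtain a b where ab: "\<tau> = Transposition.transpose a b" "a \<in> {1..n}" "b \<in> {1..n}" "a \<noteq> b"
    using \<tau> by (rule transpositionsE)
  have perm_on: "\<sigma> permutes {1..n}" "\<sigma> \<circ> \<tau> permutes {1..n}"
    using \<sigma> comp_transposition_in_perms[OF \<sigma> \<tau>] by (simp_all add: perms_def)
  then have perm: "permutation \<sigma>" "permutation (\<sigma> \<circ> \<tau>)" by (auto simp: permutation_permutes)
  show ?thesis
  proof (cases "b \<in> orbit \<sigma> a")
    case True
    obtain k where k: "0 < k" "k < card (orbit \<sigma> a)" "b = (\<sigma> ^^ k) a"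
      using mem_orbit_funpow_less[OF perm(1) True ab(4)] .
    note split = orbits_split[OF perm_on(1) _ ab(2) k(1,2), folded k(3) ab(1)]
    have "orbit (\<sigma> \<circ> \<tau>) a \<noteq> orbit (\<sigma> \<circ> \<tau>) b"
      using split(2) orbit_nonempty[of "\<sigma> \<circ> \<tau>" a] by auto
    then have "fragmentation n \<sigma> (\<sigma> \<circ> \<tau>)"
      unfolding fragmentation_def cycles_of_def using split(1) ab(2,3)
      by (intro bexI[of _ "orbit \<sigma> a"] bexI[of _ "orbit (\<sigma> \<circ> \<tau>) a"] bexI[of _ "orbit (\<sigma> \<circ> \<tau>) b"])
        auto
    then show ?thesis using cycle_rank_split[OF \<sigma> ab(2,4) True] ab(1) by simp
  next
    case False
    have "\<not> fragmentation n \<sigma> (\<sigma> \<circ> \<tau>)"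
    proof
      assume "fragmentation n \<sigma> (\<sigma> \<circ> \<tau>)"
      then obtain z x y where zxy: "orbit (\<sigma> \<circ> \<tau>) x \<noteq> orbit (\<sigma> \<circ> \<tau>) y"
        "orbit \<sigma> z = orbit (\<sigma> \<circ> \<tau>) x \<union> orbit (\<sigma> \<circ> \<tau>) y"
        unfolding fragmentation_def cycles_of_def by blast
      have "x \<in> orbit \<sigma> z" "y \<in> orbit \<sigma> z"
        using zxy(2) permutation_self_in_orbit[OF perm(2)] by auto
      then have "y \<in> orbit \<sigma> x" using orbit_eq_iff_mem[OF perm(1)] by blast
      also have "\<dots> \<subseteq> orbit (\<sigma> \<circ> \<tau>) x"
        unfolding ab(1) using orbit_merge_mono[OF perm_on(1) _ ab(2,3) False] by simp
      finally show False using zxy(1) orbit_eq_iff_mem[OF perm(2)] by blast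
    qed
    then show ?thesis using cycle_rank_merge[OF \<sigma> ab(2,3) False] ab(1) by simp
  qed
qed

lemma walk_in_perms:
  assumes "\<And>i. i \<ge> 1 \<Longrightarrow> \<tau> i \<omega> \<in> transpositions n"
  shows "walk \<tau> k \<omega> \<in> perms n"
  by (induction k) (simp_all del: o_apply id_apply add: comp_transposition_in_perms assms)

text \<open>Every step changes the rank by exactly one, and downwards precisely when it is a
  fragmentation. So the rank reaches \<open>t\<close> at time \<open>t\<close>, the largest possible value, exactly if no
  fragmentation has occurred. The bound is part of the statement for the sake of the induction.\<close>

lemma no_fragmentation_iff_cycle_rank:
  assumes \<tau>: "\<And>i. i \<ge> 1 \<Longrightarrow> \<tau> i \<omega> \<in> transpositions n"
  shows "cycle_rank n (walk \<tau> t \<omega>) \<le> t \<and>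
    ((\<forall>k<t. \<not> fragmentation n (walk \<tau> k \<omega>) (walk \<tau> (Suc k) \<omega>)) \<longleftrightarrow> cycle_rank n (walk \<tau> t \<omega>) = t)"
proof (induction t)
  case 0
  show ?case using cycle_rank_eq_0_iff[of id n] by (simp del: id_apply)
next
  case (Suc t)
  have \<tau>': "\<tau> (Suc t) \<omega> \<in> transpositions n" by (rule \<tau>) simp
  have walk: "walk \<tau> t \<omega> \<in> perms n" using \<tau> by (rule walk_in_perms)
  note step = fragmentation_iff[OF walk \<tau>'] cycle_rank_comp_transposition[OF walk \<tau>']
  show ?case
    using Suc.IH step unfolding All_less_Suc by (auto simp del: o_apply)
qed

lemma card_sphere_paths_pos:
  assumes "\<sigma> \<in> sphere\<^sub>G n t"
  shows "card (paths (cayley_adj n) t id \<sigma>) > 0"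
proof -
  have \<sigma>: "\<sigma> \<in> perms n" "cycle_rank n \<sigma> = t"
    using assms dist_eq_cycle_rank by (auto simp: sphere\<^sub>G_def)
  then have "real (card (paths (cayley_adj n) t id \<sigma>)) > 0"
    using card_minimal_cayley_paths[of \<sigma> n] cycle_weight_prod_pos[of \<sigma> n] by simp
  then show ?thesis by simp
qed

locale transposition_walk = prob_space M for M :: "'a measure" +
  fixes n :: nat and \<tau> :: "nat \<Rightarrow> 'a \<Rightarrow> nat \<Rightarrow> nat"
  assumes iid: "iid_uniform_transpositions n M \<tau>"
begin

lemma step_measurable: "i \<ge> 1 \<Longrightarrow> \<tau> i \<in> measurable M (count_space (transpositions n))"
  using iid by (auto simp: iid_uniform_transpositions_def indep_vars_def)

lemma step_in_transpositions: "i \<ge> 1 \<Longrightarrow> \<omega> \<in> space M \<Longrightarrow> \<tau> i \<omega> \<in> transpositions n"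
  using measurable_space[OF step_measurable] by simp

lemma transpositions_nonempty: "transpositions n \<noteq> {}"
  using not_empty step_in_transpositions[of 1] by blast

lemma prob_step:
  assumes "i \<ge> 1" "s \<in> transpositions n"
  shows "prob (\<tau> i -` {s} \<inter> space M) = 1 / real (card (transpositions n))"
proof -
  have "prob (\<tau> i -` {s} \<inter> space M) = measure (distr M (count_space (transpositions n)) (\<tau> i)) {s}"
    using assms by (subst measure_distr[OF step_measurable]) auto
  also have "\<dots> = measure (uniform_count_measure (transpositions n)) {s}"
    using iid assms(1) by (simp add: iid_uniform_transpositions_def)
  finally show ?thesis
    using assms(2) by (simp add: measure_uniform_count_measure finite_transpositions)
qed

lemma prob_steps:
  assumes "\<And>i. s i \<in> transpositions n"
  shows "prob {\<omega> \<in> space M. \<forall>i\<in>{0<..u}. \<tau> i \<omega> = s i} = 1 / real (card (transpositions n)) ^ u"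
    and "{\<omega> \<in> space M. \<forall>i\<in>{0<..u}. \<tau> i \<omega> = s i} \<in> events"
proof -
  let ?E = "{\<omega> \<in> space M. \<forall>i\<in>{0<..u}. \<tau> i \<omega> = s i}"
  have "?E \<in> events \<and> prob ?E = 1 / real (card (transpositions n)) ^ u"
  proof (cases "u = 0")
    case False
    have eq: "?E = (\<Inter>i\<in>{0<..u}. \<tau> i -` {s i} \<inter> space M)"
      using False by auto
    have ev: "\<tau> i -` {s i} \<inter> space M \<in> events" if "i \<in> {0<..u}" for i
      using that assms[of i] by (intro measurable_sets[OF step_measurable]) auto
    have indep: "indep_vars (\<lambda>_. count_space (transpositions n)) \<tau> {1..}"
      using iid by (simp add: iid_uniform_transpositions_def)
    have "prob (\<Inter>i\<in>{0<..u}. \<tau> i -` {s i} \<inter> space M)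
        = (\<Prod>i\<in>{0<..u}. prob (\<tau> i -` {s i} \<inter> space M))"
      using False assms by (intro indep_varsD[OF indep]) auto
    also have "\<dots> = (\<Prod>i\<in>{0<..u}. 1 / real (card (transpositions n)))"
      using assms by (intro prod.cong prob_step) auto
    moreover have "(\<Inter>i\<in>{0<..u}. \<tau> i -` {s i} \<inter> space M) \<in> events"
      using False ev by (intro sets.finite_INT) auto
    ultimately show ?thesis
      unfolding eq by (simp add: power_one_over)
  qed (simp add: prob_space)
  then show "prob ?E = 1 / real (card (transpositions n)) ^ u" "?E \<in> events" by auto
qed

text \<open>All words of \<open>u\<close> transpositions are equally likely, and the prefixes of length \<open>k\<close> with
  product \<open>\<sigma>\<close> correspond to the paths of length \<open>k\<close> to \<open>\<sigma>\<close>. Prescribing the later steps as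
  well makes the induction on \<open>k\<close> work: the induction step moves the step \<open>k + 1\<close> from the
  prescribed part into the walk, and only the joint law of the steps is ever used.\<close>

lemma prob_walk_and_later_steps:
  assumes "\<sigma> \<in> perms n" "\<And>i. s i \<in> transpositions n" "k \<le> u"
  shows "{\<omega> \<in> space M. walk \<tau> k \<omega> = \<sigma> \<and> (\<forall>i\<in>{k<..u}. \<tau> i \<omega> = s i)} \<in> events \<and>
    prob {\<omega> \<in> space M. walk \<tau> k \<omega> = \<sigma> \<and> (\<forall>i\<in>{k<..u}. \<tau> i \<omega> = s i)}
      = real (card (paths (cayley_adj n) k id \<sigma>)) / real (card (transpositions n)) ^ u"
  using assms
proof (induction k arbitrary: \<sigma> s)
  case 0
  then show ?case
    using prob_steps[of s u] by (cases "\<sigma> = id") (auto simp: paths_0 simp del: id_apply)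
next
  case (Suc k)
  define E where "E = (\<lambda>k \<sigma> s. {\<omega> \<in> space M. walk \<tau> k \<omega> = \<sigma> \<and> (\<forall>i\<in>{k<..u}. \<tau> i \<omega> = s i)})"
  let ?F = "\<lambda>t. E k (\<sigma> \<circ> t) (s(Suc k := t))"
  have IH: "?F t \<in> events \<and> prob (?F t)
      = real (card (paths (cayley_adj n) k id (\<sigma> \<circ> t))) / real (card (transpositions n)) ^ u"
    if "t \<in> transpositions n" for t
    unfolding E_def using Suc.prems that
    by (intro Suc.IH comp_transposition_in_perms) (auto simp del: o_apply)
  have interval: "{k<..u} = insert (Suc k) {Suc k<..u}" using Suc.prems(3) by auto
  have eq: "E (Suc k) \<sigma> s = (\<Union>t\<in>transpositions n. ?F t)"
  proof (intro subset_antisym subsetI)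
    fix \<omega> assume \<omega>: "\<omega> \<in> E (Suc k) \<sigma> s"
    then have t: "\<tau> (Suc k) \<omega> \<in> transpositions n"
      using step_in_transpositions by (simp add: E_def)
    have "walk \<tau> k \<omega> = \<sigma> \<circ> \<tau> (Suc k) \<omega>"
      using \<omega> comp_transposition_cancel[OF t, of "walk \<tau> k \<omega>"] by (auto simp: E_def)
    then have "\<omega> \<in> ?F (\<tau> (Suc k) \<omega>)"
      using \<omega> unfolding E_def interval by auto
    with t show "\<omega> \<in> (\<Union>t\<in>transpositions n. ?F t)" by blast
  next
    fix \<omega> assume "\<omega> \<in> (\<Union>t\<in>transpositions n. ?F t)"
    then obtain t where t: "t \<in> transpositions n" "\<omega> \<in> ?F t" by blast
    then have "walk \<tau> (Suc k) \<omega> = \<sigma>"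
      unfolding E_def interval using comp_transposition_cancel[OF t(1), of \<sigma>] by simp
    moreover have "\<omega> \<in> space M" "\<forall>i\<in>{Suc k<..u}. \<tau> i \<omega> = s i"
      using t(2) unfolding E_def interval by auto
    ultimately show "\<omega> \<in> E (Suc k) \<sigma> s"
      unfolding E_def by blast
  qed
  have disj: "disjoint_family_on ?F (transpositions n)"
    unfolding disjoint_family_on_def E_def interval by auto
  have "prob (E (Suc k) \<sigma> s) = (\<Sum>t\<in>transpositions n. prob (?F t))"
    unfolding eq using IH disj finite_transpositions by (intro finite_measure_finite_Union) auto
  also have "\<dots> = real (card (paths (cayley_adj n) (Suc k) id \<sigma>)) / real (card (transpositions n)) ^ u"
    using IH by (simp add: card_cayley_paths_Suc[OF Suc.prems(1)] sum_divide_distrib)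
  finally have "prob (E (Suc k) \<sigma> s) = \<dots>" .
  moreover have "E (Suc k) \<sigma> s \<in> events"
    unfolding eq using IH finite_transpositions by blast
  ultimately show ?case unfolding E_def by blast
qed

lemma prob_walk:
  assumes "\<sigma> \<in> perms n"
  shows "walk \<tau> t -` {\<sigma>} \<inter> space M \<in> events"
    and "prob (walk \<tau> t -` {\<sigma>} \<inter> space M)
      = real (card (paths (cayley_adj n) t id \<sigma>)) / real (card (transpositions n)) ^ t"
proof -
  obtain s where "s \<in> transpositions n" using transpositions_nonempty by blast
  moreover have "walk \<tau> t -` {\<sigma>} \<inter> space M
      = {\<omega> \<in> space M. walk \<tau> t \<omega> = \<sigma> \<and> (\<forall>i\<in>{t<..t}. \<tau> i \<omega> = s)}" by auto
  ultimately show "walk \<tau> t -` {\<sigma>} \<inter> space M \<in> events"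
    "prob (walk \<tau> t -` {\<sigma>} \<inter> space M)
      = real (card (paths (cayley_adj n) t id \<sigma>)) / real (card (transpositions n)) ^ t"
    using prob_walk_and_later_steps[OF assms, of "\<lambda>_. s" t t] by auto
qed

lemma walk_measurable: "walk \<tau> t \<in> measurable M (count_space (perms n))"
proof -
  have "walk \<tau> t \<omega> \<in> perms n" if "\<omega> \<in> space M" for \<omega>
    using step_in_transpositions that by (intro walk_in_perms) auto
  then show ?thesis
    using prob_walk(1) by (auto simp: measurable_count_space_eq2 finite_perms)
qed

lemma prob_walk_in:
  assumes "X \<subseteq> perms n"
  shows "prob (walk \<tau> t -` X \<inter> space M)
    = (\<Sum>\<sigma>\<in>X. real (card (paths (cayley_adj n) t id \<sigma>))) / real (card (transpositions n)) ^ t"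
proof -
  have fin: "finite X" using assms finite_perms by (rule finite_subset)
  have "walk \<tau> t -` X \<inter> space M = (\<Union>\<sigma>\<in>X. walk \<tau> t -` {\<sigma>} \<inter> space M)" by auto
  also have "prob \<dots> = (\<Sum>\<sigma>\<in>X. prob (walk \<tau> t -` {\<sigma>} \<inter> space M))"
    using fin assms prob_walk(1)
    by (intro finite_measure_finite_Union) (auto simp: disjoint_family_on_def)
  also have "\<dots> = (\<Sum>\<sigma>\<in>X. real (card (paths (cayley_adj n) t id \<sigma>)) / real (card (transpositions n)) ^ t)"
    using assms by (intro sum.cong refl prob_walk(2)) auto
  finally show ?thesis by (simp add: sum_divide_distrib)
qed

text \<open>This identifies the two descriptions of the conditioning: no fragmentation before time \<open>t\<close>
  and position at distance \<open>t\<close> at time \<open>t\<close>.\<close>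

lemma no_fragmentation_eq_sphere_hit:
  "no_fragmentation n M \<tau> t = walk \<tau> t -` sphere\<^sub>G n t \<inter> space M"
proof -
  have "(\<forall>k<t. \<not> fragmentation n (walk \<tau> k \<omega>) (walk \<tau> (Suc k) \<omega>)) \<longleftrightarrow> walk \<tau> t \<omega> \<in> sphere\<^sub>G n t"
    if "\<omega> \<in> space M" for \<omega>
  proof -
    have \<tau>: "\<And>i. i \<ge> 1 \<Longrightarrow> \<tau> i \<omega> \<in> transpositions n" using step_in_transpositions that by blast
    then show ?thesis
      using no_fragmentation_iff_cycle_rank[of \<tau> \<omega> n t, OF \<tau>] walk_in_perms[of \<tau> \<omega> n t, OF \<tau>]
        dist_eq_cycle_rank by (simp add: sphere\<^sub>G_def)
  qed
  then show ?thesis unfolding no_fragmentation_def by blast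
qed

text \<open>The common probability of a single path cancels in the conditional probability and leaves a
  quotient of path counts.\<close>

lemma emeasure_no_frag_law:
  assumes X: "X \<subseteq> perms n"
  shows "emeasure (no_frag_law n M \<tau> t) X
    = ennreal ((\<Sum>\<sigma>\<in>X \<inter> sphere\<^sub>G n t. real (card (paths (cayley_adj n) t id \<sigma>)))
        / (\<Sum>\<sigma>\<in>sphere\<^sub>G n t. real (card (paths (cayley_adj n) t id \<sigma>))))"
proof -
  define S where "S = sphere\<^sub>G n t"
  define N where "N = (\<lambda>\<sigma>. real (card (paths (cayley_adj n) t id \<sigma>)))"
  define T where "T = real (card (transpositions n)) ^ t"
  have S: "S \<subseteq> perms n" by (auto simp: S_def sphere\<^sub>G_def)
  then have fin: "finite S" using finite_perms by (rule finite_subset)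
  have "T > 0"
    using transpositions_nonempty finite_transpositions by (simp add: T_def card_gt_0_iff)
  let ?hit = "\<lambda>Y. walk \<tau> t -` Y \<inter> space M"
  have ev: "?hit Y \<in> events" if "Y \<subseteq> perms n" for Y
    using that by (intro measurable_sets[OF walk_measurable]) simp
  have "emeasure (no_frag_law n M \<tau> t) X = emeasure (uniform_measure M (?hit S)) (?hit X)"
    unfolding no_frag_law_def no_fragmentation_eq_sphere_hit S_def[symmetric]
    using X walk_measurable by (subst emeasure_distr) auto
  also have "\<dots> = emeasure M (?hit S \<inter> ?hit X) / emeasure M (?hit S)"
    using ev X S by (intro emeasure_uniform_measure) auto
  also have "?hit S \<inter> ?hit X = ?hit (X \<inter> S)" by auto
  also have "emeasure M (?hit (X \<inter> S)) = ennreal (sum N (X \<inter> S) / T)"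
    using prob_walk_in[of "X \<inter> S" t] X by (simp add: emeasure_eq_measure N_def T_def le_infI1)
  also have "emeasure M (?hit S) = ennreal (sum N S / T)"
    using prob_walk_in[OF S, of t] by (simp add: emeasure_eq_measure N_def T_def)
  also have "ennreal (sum N (X \<inter> S) / T) / ennreal (sum N S / T) = ennreal (sum N (X \<inter> S) / sum N S)"
  proof (cases "S = {}")
    case False
    have "sum N S > 0"
      using fin False card_sphere_paths_pos[of _ n t] by (intro sum_pos) (auto simp: S_def N_def)
    moreover have "sum N (X \<inter> S) \<ge> 0" by (intro sum_nonneg) (simp add: N_def)
    ultimately show ?thesis using \<open>T > 0\<close> by (simp add: divide_ennreal)
  qed simp
  finally show ?thesis unfolding S_def N_def .
qed

end

section \<open>The Radon-Nikodym derivative\<close>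

lemma emeasure_sphere_law:
  assumes "X \<subseteq> perms n"
  shows "emeasure (sphere_law n t) X
    = ennreal (real (card (X \<inter> sphere\<^sub>G n t)) / real (card (sphere\<^sub>G n t)))"
proof -
  define S where "S = sphere\<^sub>G n t"
  have S: "S \<subseteq> perms n" by (auto simp: S_def sphere\<^sub>G_def)
  then have fin: "finite S" "finite (S \<inter> X)" using finite_perms finite_subset by blast+
  have "emeasure (sphere_law n t) X = of_nat (card (S \<inter> X)) / of_nat (card S)"
    unfolding sphere_law_def S_def[symmetric] using assms S fin
    by (subst emeasure_uniform_measure) (auto simp: emeasure_count_space le_infI1)
  also have "\<dots> = ennreal (real (card (S \<inter> X)) / real (card S))"
  proof (cases "S = {}")
    case False
    then show ?thesis
      unfolding ennreal_of_nat_eq_real_of_nat using fin by (simp add: divide_ennreal card_gt_0_iff)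
  qed simp
  finally show ?thesis by (simp add: S_def Int_commute)
qed

lemma (in transposition_walk) absolutely_continuous_no_frag_law:
  "absolutely_continuous (sphere_law n t) (no_frag_law n M \<tau> t)"
  unfolding absolutely_continuous_def
proof
  fix X assume X: "X \<in> null_sets (sphere_law n t)"
  then have sub: "X \<subseteq> perms n"
    by (auto simp: sphere_law_def null_sets_def)
  have fin: "finite (sphere\<^sub>G n t)"
    by (rule finite_subset[OF _ finite_perms[of n]]) (auto simp: sphere\<^sub>G_def)
  have "X \<inter> sphere\<^sub>G n t = {}"
    using X fin unfolding null_sets_def by (auto simp: emeasure_sphere_law[OF sub] divide_le_0_iff card_eq_0_iff)
  then have "emeasure (no_frag_law n M \<tau> t) X = 0"
    by (simp add: emeasure_no_frag_law[OF sub])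
  then show "X \<in> null_sets (no_frag_law n M \<tau> t)"
    using sub by (auto simp: null_sets_def no_frag_law_def)
qed

text \<open>The derivative is determined only up to null sets, but a point \<open>\<sigma>\<close> of the sphere has
  positive mass under the uniform law. Integrating the derivative over \<open>{\<sigma>}\<close> therefore
  gives its value there as the quotient of the two masses of \<open>\<sigma>\<close>.\<close>

lemma (in transposition_walk) RN_deriv_no_frag_law:
  assumes \<sigma>: "\<sigma> \<in> sphere\<^sub>G n t"
  shows "RN_deriv (sphere_law n t) (no_frag_law n M \<tau> t) \<sigma>
    = ennreal (real (card (sphere\<^sub>G n t)) * real (card (paths (cayley_adj n) t id \<sigma>))
        / (\<Sum>\<rho>\<in>sphere\<^sub>G n t. real (card (paths (cayley_adj n) t id \<rho>))))"
proof -
  define c where "c = real (card (sphere\<^sub>G n t))"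
  define r where "r = real (card (paths (cayley_adj n) t id \<sigma>))
        / (\<Sum>\<rho>\<in>sphere\<^sub>G n t. real (card (paths (cayley_adj n) t id \<rho>)))"
  let ?R = "RN_deriv (sphere_law n t) (no_frag_law n M \<tau> t)"
  have sub: "sphere\<^sub>G n t \<subseteq> perms n" by (auto simp: sphere\<^sub>G_def)
  then have fin: "finite (sphere\<^sub>G n t)" using finite_perms by (rule finite_subset)
  then have "c > 0" using \<sigma> by (auto simp: c_def card_gt_0_iff)
  have int: "{\<sigma>} \<inter> sphere\<^sub>G n t = {\<sigma>}" using \<sigma> by auto
  have \<sigma>_perms: "{\<sigma>} \<subseteq> perms n" using \<sigma> sub by auto
  have sets: "sets (sphere_law n t) = Pow (perms n)" "space (sphere_law n t) = perms n"
    by (simp_all add: sphere_law_def)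
  interpret S: finite_measure "sphere_law n t"
    by (rule finite_measureI) (simp add: sets emeasure_sphere_law)
  have "density (sphere_law n t) ?R = no_frag_law n M \<tau> t"
    by (rule S.density_RN_deriv[OF absolutely_continuous_no_frag_law])
      (simp add: sphere_law_def no_frag_law_def)
  then have "emeasure (no_frag_law n M \<tau> t) {\<sigma>} = emeasure (density (sphere_law n t) ?R) {\<sigma>}"
    by simp
  also have "\<dots> = ?R \<sigma> * emeasure (sphere_law n t) {\<sigma>}"
    using \<sigma>_perms by (subst emeasure_density) (auto simp: sets nn_integral_indicator_singleton)
  finally have eq: "ennreal r = ?R \<sigma> * ennreal (1 / c)"
    unfolding emeasure_no_frag_law[OF \<sigma>_perms] emeasure_sphere_law[OF \<sigma>_perms] int
    by (simp add: r_def c_def)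
  have "?R \<sigma> = ?R \<sigma> * (ennreal (1 / c) * ennreal c)"
    using \<open>c > 0\<close> by (simp flip: ennreal_mult)
  also have "\<dots> = ennreal r * ennreal c"
    unfolding eq by (simp only: mult.assoc)
  also have "\<dots> = ennreal (c * r)"
    using \<open>c > 0\<close> by (simp add: r_def mult.commute sum_nonneg flip: ennreal_mult)
  finally show ?thesis by (simp add: c_def r_def)
qed

lemma card_shortest_paths:
  assumes "\<sigma> \<in> perms n"
  shows "real (card (paths (cayley_adj n) (dist\<^sub>G n \<sigma>) id \<sigma>))
    = fact (dist\<^sub>G n \<sigma>) * (\<Prod>m\<in>#cycle_lengths n \<sigma>. real m powi (int m - 2) / fact (m - 1))"
  using card_minimal_cayley_paths[OF assms]
  unfolding dist_eq_cycle_rank[OF assms] prod_cycle_lengths cycle_weight_def .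


theorem theorem6:
  shows "(\<forall>n t \<sigma>. \<sigma> \<in> perms n \<and> dist\<^sub>G n \<sigma> = t \<longrightarrow>
            real (card (paths (cayley_adj n) t id \<sigma>))
              = fact t * (\<Prod>m\<in>#cycle_lengths n \<sigma>. real m powi (int m - 2) / fact (m - 1)))
       \<and> (\<exists>K :: nat \<Rightarrow> nat \<Rightarrow> real.
            \<forall>(n :: nat) (c :: real) (t :: nat) (M :: 'a measure) (\<tau> :: nat \<Rightarrow> 'a \<Rightarrow> nat \<Rightarrow> nat).
              0 < c \<and> c < 1 \<and> t = nat \<lfloor>c * real n / 2\<rfloor> \<and> iid_uniform_transpositions n M \<tau> \<longrightarrow>
                absolutely_continuous (sphere_law n t) (no_frag_law n M \<tau> t) \<and>
                (\<forall>\<sigma>\<in>sphere\<^sub>G n t.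
                   RN_deriv (sphere_law n t) (no_frag_law n M \<tau> t) \<sigma>
                     = ennreal (K n t *
                         (\<Prod>m\<in>#cycle_lengths n \<sigma>. real m powi (int m - 2) / fact (m - 1)))))"
proof (intro conjI allI impI)
  fix n t \<sigma> assume "\<sigma> \<in> perms n \<and> dist\<^sub>G n \<sigma> = t"
  then show "real (card (paths (cayley_adj n) t id \<sigma>))
      = fact t * (\<Prod>m\<in>#cycle_lengths n \<sigma>. real m powi (int m - 2) / fact (m - 1))"
    using card_shortest_paths by blast
next
  \<comment> \<open>Summing the densities to total mass 1 forces this normalising constant.\<close>
  define K where "K = (\<lambda>n t. real (card (sphere\<^sub>G n t)) * fact t
      / (\<Sum>\<rho>\<in>sphere\<^sub>G n t. real (card (paths (cayley_adj n) t id \<rho>))))"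
  have "absolutely_continuous (sphere_law n t) (no_frag_law n M \<tau> t) \<and>
      (\<forall>\<sigma>\<in>sphere\<^sub>G n t. RN_deriv (sphere_law n t) (no_frag_law n M \<tau> t) \<sigma>
         = ennreal (K n t * (\<Prod>m\<in>#cycle_lengths n \<sigma>. real m powi (int m - 2) / fact (m - 1))))"
    if "iid_uniform_transpositions n M \<tau>" for n t and M :: "'a measure" and \<tau>
  proof -
    have "prob_space M" using that by (simp add: iid_uniform_transpositions_def)
    with that interpret transposition_walk M n \<tau>
      by (simp add: transposition_walk_def transposition_walk_axioms_def)
    show ?thesis
    proof (intro conjI ballI absolutely_continuous_no_frag_law)
      fix \<sigma> assume \<sigma>: "\<sigma> \<in> sphere\<^sub>G n t"
      then have "\<sigma> \<in> perms n" "dist\<^sub>G n \<sigma> = t" by (simp_all add: sphere\<^sub>G_def)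
      with card_shortest_paths[of \<sigma> n]
      show "RN_deriv (sphere_law n t) (no_frag_law n M \<tau> t) \<sigma>
          = ennreal (K n t * (\<Prod>m\<in>#cycle_lengths n \<sigma>. real m powi (int m - 2) / fact (m - 1)))"
        unfolding RN_deriv_no_frag_law[OF \<sigma>] by (simp add: K_def mult.assoc)
    qed
  qed
  then show "\<exists>K :: nat \<Rightarrow> nat \<Rightarrow> real.
            \<forall>(n :: nat) (c :: real) (t :: nat) (M :: 'a measure) (\<tau> :: nat \<Rightarrow> 'a \<Rightarrow> nat \<Rightarrow> nat).
              0 < c \<and> c < 1 \<and> t = nat \<lfloor>c * real n / 2\<rfloor> \<and> iid_uniform_transpositions n M \<tau> \<longrightarrow>
                absolutely_continuous (sphere_law n t) (no_frag_law n M \<tau> t) \<and>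
                (\<forall>\<sigma>\<in>sphere\<^sub>G n t.
                   RN_deriv (sphere_law n t) (no_frag_law n M \<tau> t) \<sigma>
                     = ennreal (K n t *
                         (\<Prod>m\<in>#cycle_lengths n \<sigma>. real m powi (int m - 2) / fact (m - 1))))"
    by blast
qed

end
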